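(* Let $N\ge1$ be odd, let $\omega\in\mathbb{C}$ with $|\omega|=1$, and let $a_0,\dots,a_{N-1}\in\mathbb{C}$ with $|a_n|<1$ for all $n$. Let $\mathcal{M}_1,\mathcal{M}_2$ be the CMV factors of size $N+1$ built from $(a_n)_{n=0}^{N-1}$ and $\omega$, and let $\hat{\mathcal{M}}_1,\hat{\mathcal{M}}_2$ be the matrices built in the same way from the mirror dual coefficients $\hat a_n=-\omega\,\overline{a_{N-n-1}}$, $n=0,\dots,N-1$, and the same $\omega$. Then, with $\tau=\omega^{-1/2}$ (any fixed square root), $$\hat{\mathcal{M}}_1=Q_N(\tau^{-1})\,\mathcal{M}_1\,Q_N(\tau),\qquad \hat{\mathcal{M}}_2=Q_N(\tau)\,\mathcal{M}_2\,Q_N(\tau^{-1}).$$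
   Context: Put $\rho_k=\sqrt{1-|a_k|^2}$ and $\Theta_k=\begin{pmatrix}\overline{a_k}&\rho_k\\ \rho_k&-a_k\end{pmatrix}$. For odd $N$ the CMV factors are the block-diagonal $(N+1)\times(N+1)$ matrices $$\mathcal{M}_1=(1)\oplus\Theta_1\oplus\Theta_3\oplus\dots\oplus\Theta_{N-2}\oplus(\omega^{-1}),\qquad \mathcal{M}_2=\Theta_0\oplus\Theta_2\oplus\dots\oplus\Theta_{N-1}.$$ For $|\tau|=1$, the quasi-reflection matrix $Q_N(\tau)$ is the $(N+1)\times(N+1)$ matrix (rows and columns indexed by $0,\dots,N$) whose only nonzero entries are on the main antidiagonal, with entry $\tau^{(-1)^k}$ in position $(k,N-k)$, i.e. alternating $\tau,\tau^{-1},\tau,\dots$ starting with $\tau$ in the top right corner. *)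

theory Defs
  imports Complex_Main "Jordan_Normal_Form.Matrix"
begin

definition cmv_rho :: "complex \<Rightarrow> real" where
  "cmv_rho z = sqrt (1 - (cmod z)\<^sup>2)"

definition cmv_Theta :: "complex \<Rightarrow> complex mat" where
  "cmv_Theta z = mat_of_rows_list 2
     [[cnj z, complex_of_real (cmv_rho z)],
      [complex_of_real (cmv_rho z), - z]]"

definition scalar_block :: "complex \<Rightarrow> complex mat" where
  "scalar_block c = mat_of_rows_list 1 [[c]]"

(* Both factors are only meaningful for odd N, as in the construction they come from.
   cmv_M1 has the blocks (1), Theta_1, Theta_3, ..., Theta_(N-2), (1/\<omega>), with no Theta blocks
   when N = 1; cmv_M2 has the blocks Theta_0, Theta_2, ..., Theta_(N-1). *)

definition cmv_M1 :: "nat \<Rightarrow> complex \<Rightarrow> (nat \<Rightarrow> complex) \<Rightarrow> complex mat" where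
  "cmv_M1 N \<omega> a = diag_block_mat
     ([scalar_block 1]
      @ map (\<lambda>j. cmv_Theta (a (2 * j + 1))) [0..<(N - 1) div 2]
      @ [scalar_block (inverse \<omega>)])"

definition cmv_M2 :: "nat \<Rightarrow> (nat \<Rightarrow> complex) \<Rightarrow> complex mat" where
  "cmv_M2 N a = diag_block_mat
     (map (\<lambda>j. cmv_Theta (a (2 * j))) [0..<(N + 1) div 2])"

definition mirror_dual :: "nat \<Rightarrow> complex \<Rightarrow> (nat \<Rightarrow> complex) \<Rightarrow> nat \<Rightarrow> complex" where
  "mirror_dual N \<omega> a n = - \<omega> * cnj (a (N - n - 1))"

definition quasi_reflection :: "nat \<Rightarrow> complex \<Rightarrow> complex mat" where
  "quasi_reflection N \<tau> = mat (N + 1) (N + 1)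
     (\<lambda>(k, l). if l = N - k then \<tau> powi ((-1) ^ k) else 0)"

lemma cmv_Theta_carrier [simp]: "cmv_Theta z \<in> carrier_mat 2 2"
  by (rule carrier_matI) (simp_all add: cmv_Theta_def mat_of_rows_list_def)

lemma scalar_block_carrier [simp]: "scalar_block c \<in> carrier_mat 1 1"
  by (rule carrier_matI) (simp_all add: scalar_block_def mat_of_rows_list_def)

lemma quasi_reflection_carrier [simp]:
  "quasi_reflection N \<tau> \<in> carrier_mat (N + 1) (N + 1)"
  by (simp add: quasi_reflection_def)

lemma cmv_M1_carrier:
  assumes "odd N"
  shows "cmv_M1 N \<omega> a \<in> carrier_mat (N + 1) (N + 1)"
  using assms
  by (auto simp: sum_list_triv cmv_M1_def dim_diag_block_mat comp_def cmv_Theta_def scalar_block_def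
      mat_of_rows_list_def elim!: oddE intro!: carrier_matI)

lemma cmv_M2_carrier:
  assumes "odd N"
  shows "cmv_M2 N a \<in> carrier_mat (N + 1) (N + 1)"
  using assms
  by (auto simp: sum_list_triv cmv_M2_def dim_diag_block_mat comp_def cmv_Theta_def
      mat_of_rows_list_def elim!: oddE intro!: carrier_matI)

end

theory Submission
  imports Defs
begin

text \<open>Conjugation by the quasi-reflection reverses the order of the rows and columns and multiplies
  the entry in position \<open>(k, l)\<close> by \<open>\<tau>\<close> to the power \<open>(-1)\<^sup>k + (-1)\<^sup>l\<close>. The reversal
  permutes the blocks of each factor, so everything reduces to the single block identity
  \<open>cmv_Theta_mirror\<close>.\<close>

lemma quasi_reflection_conj_index:
  assumes M: "M \<in> carrier_mat (N + 1) (N + 1)" and "odd N" and k: "k \<le> N" and l: "l \<le> N"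
  shows "(quasi_reflection N \<sigma> * M * quasi_reflection N (inverse \<sigma>)) $$ (k, l)
    = \<sigma> powi ((-1) ^ k) * \<sigma> powi ((-1) ^ l) * M $$ (N - k, N - l)"
proof -
  let ?Q = "quasi_reflection N"
  have QM: "(?Q \<sigma> * M) $$ (k, j) = \<sigma> powi ((-1) ^ k) * M $$ (N - k, j)" if "j \<le> N" for j
  proof -
    have "(?Q \<sigma> * M) $$ (k, j)
      = (\<Sum>i = 0..<Suc N. (if i = N - k then \<sigma> powi ((-1) ^ k) else 0) * M $$ (i, j))"
      using M that k by (auto simp: quasi_reflection_def scalar_prod_def intro!: sum.cong)
    also have "\<dots> = (\<Sum>i = 0..<Suc N. if i = N - k then \<sigma> powi ((-1) ^ k) * M $$ (i, j) else 0)"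
      by (rule sum.cong) auto
    finally show ?thesis by simp
  qed
  \<comment> \<open>Column \<open>l\<close> of the right factor is nonzero only in row
    \<open>N - l\<close>. As \<open>N\<close> is odd, \<open>l\<close> and \<open>N - l\<close> have
    opposite parity, so the sign of the exponent flips and cancels the inversion of \<sigma>; both
    sides thus contribute a power of the same \<sigma>.\<close>
  have sgn: "inverse \<sigma> powi ((-1) ^ (N - l)) = \<sigma> powi ((-1) ^ l)"
  proof (cases "even l")
    case True
    then have "odd (N - l)" using \<open>odd N\<close> l by simp
    then show ?thesis using True by (simp add: power_int_minus)
  next
    case False
    then have "even (N - l)" using \<open>odd N\<close> l by simp
    then show ?thesis using False by (simp add: power_int_minus)
  qed
  have "(?Q \<sigma> * M * ?Q (inverse \<sigma>)) $$ (k, l)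
    = (\<Sum>j = 0..<Suc N. (?Q \<sigma> * M) $$ (k, j)
        * (if l = N - j then inverse \<sigma> powi ((-1) ^ j) else 0))"
    using M k l by (auto simp: quasi_reflection_def scalar_prod_def simp del: index_mult_mat(1)
        intro!: sum.cong) (auto simp: scalar_prod_def)
  also have "\<dots> = (\<Sum>j = 0..<Suc N. if j = N - l
      then (?Q \<sigma> * M) $$ (k, j) * inverse \<sigma> powi ((-1) ^ j) else 0)"
    using l by (intro sum.cong) auto
  also have "\<dots> = (?Q \<sigma> * M) $$ (k, N - l) * inverse \<sigma> powi ((-1) ^ (N - l))"
    by simp
  finally show ?thesis using QM[of "N - l"] sgn by simp
qed

text \<open>With blocks of one common size, division with remainder by \<open>n\<close> splits an
  index into the number of its block and its position inside that block.\<close>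

lemma diag_block_mat_index:
  assumes "\<forall>A \<in> set As. A \<in> carrier_mat n n" and "i < n * length As" and "j < n * length As"
  shows "diag_block_mat As $$ (i, j)
    = (if i div n = j div n then As ! (i div n) $$ (i mod n, j mod n) else 0)"
  using assms
proof (induction As arbitrary: i j)
  case (Cons A As)
  have n: "n > 0" using Cons.prems by (cases n) auto
  have A: "dim_row A = n" "dim_col A = n" using Cons.prems by auto
  have "map dim_row As = map (\<lambda>_. n) As" "map dim_col As = map (\<lambda>_. n) As"
    using Cons.prems by auto
  then have D: "dim_row (diag_block_mat As) = n * length As"
    "dim_col (diag_block_mat As) = n * length As"
    by (simp_all only: dim_diag_block_mat) (simp_all add: sum_list_triv mult.commute)
  have idx: "diag_block_mat (A # As) $$ (i, j)
    = (if i < n then if j < n then A $$ (i, j) else 0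
       else if j < n then 0 else diag_block_mat As $$ (i - n, j - n))"
    using Cons.prems by (auto simp: Let_def A D)
  \<comment> \<open>Removing the first block lowers the block number by one and keeps the position
    inside the block.\<close>
  have shift: "x div n = Suc ((x - n) div n)" "x mod n = (x - n) mod n" if "\<not> x < n" for x
    using that n by (simp_all add: le_div_geq le_mod_geq)
  show ?case
  proof (cases "i < n \<or> j < n")
    case True
    then show ?thesis unfolding idx by (auto simp: shift)
  next
    case False
    then have "diag_block_mat As $$ (i - n, j - n) =
      (if (i - n) div n = (j - n) div n
       then As ! ((i - n) div n) $$ ((i - n) mod n, (j - n) mod n) else 0)"
      using Cons.prems by (intro Cons.IH) auto
    then show ?thesis using False unfolding idx by (simp add: shift)
  qed
qed simp

text \<open>Reversing both indices swaps the diagonal entries. Since the conjugate of \<omega> is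
  its inverse, the new corner entries are \<open>\<tau>\<^sup>2\<close> times \<open>- z\<close> and
  \<open>\<tau>\<close> to the power -2 times \<open>cnj z\<close>. Off the diagonal the two weights
  cancel, and \<open>cmv_rho\<close> is unchanged because \<omega> has modulus 1.\<close>

lemma cmv_Theta_mirror:
  assumes "cmod \<omega> = 1" and "\<tau>\<^sup>2 = inverse \<omega>" and "r < 2" and "s < 2"
  shows "cmv_Theta (- \<omega> * cnj z) $$ (r, s)
    = \<tau> powi ((-1) ^ r) * \<tau> powi ((-1) ^ s) * cmv_Theta z $$ (1 - r, 1 - s)"
proof -
  have "\<omega> * cnj \<omega> = 1"
    using assms(1) by (simp add: complex_norm_square[symmetric])
  then have cnj: "cnj \<omega> = inverse \<omega>"
    by (metis inverse_unique)
  have "\<tau> \<noteq> 0" using assms(1,2) by auto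
  have sq: "\<tau> * \<tau> = inverse \<omega>" "inverse \<tau> * inverse \<tau> = \<omega>"
    using assms(2) by (simp_all add: power2_eq_square flip: inverse_mult_distrib)
  have "r = 0 \<or> r = 1" "s = 0 \<or> s = 1" using assms(3,4) by auto
  then show ?thesis
    using assms(1) \<open>\<tau> \<noteq> 0\<close>
    by (auto simp: cmv_Theta_def mat_of_rows_list_def cmv_rho_def norm_mult cnj sq power_int_minus)
qed

lemma cmv_M2_index:
  assumes "p < n" and "q < n" and "r < 2" and "s < 2"
  shows "cmv_M2 (2 * n - 1) a $$ (2 * p + r, 2 * q + s)
    = (if p = q then cmv_Theta (a (2 * p)) $$ (r, s) else 0)"
  using assms
  by (auto simp: cmv_M2_def diag_block_mat_index[where n = 2])

lemma cmv_M1_index: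
  assumes "odd N" and "k \<le> N" and "l \<le> N"
  shows "cmv_M1 N \<omega> a $$ (k, l)
    = (if k = 0 \<or> l = 0 then if k = l then 1 else 0
       else if k = N \<or> l = N then if k = l then inverse \<omega> else 0
       else if (k - 1) div 2 = (l - 1) div 2
         then cmv_Theta (a (2 * ((k - 1) div 2) + 1)) $$ ((k - 1) mod 2, (l - 1) mod 2)
       else 0)"
proof -
  obtain n where N: "N = 2 * n + 1" using \<open>odd N\<close> by (rule oddE)
  define Ts where "Ts = map (\<lambda>j. cmv_Theta (a (2 * j + 1))) [0..<n]"
  define D where "D = diag_block_mat Ts"
  have Ts: "\<forall>A \<in> set Ts. A \<in> carrier_mat 2 2" "length Ts = n"
    by (auto simp: Ts_def)
  then have "map dim_row Ts = map (\<lambda>_. 2) Ts" "map dim_col Ts = map (\<lambda>_. 2) Ts"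
    by auto
  then have D: "dim_row D = 2 * n" "dim_col D = 2 * n"
    unfolding D_def by (simp_all only: dim_diag_block_mat) (simp_all add: sum_list_triv Ts)
  have D_index: "D $$ (i, j)
    = (if i div 2 = j div 2 then cmv_Theta (a (2 * (i div 2) + 1)) $$ (i mod 2, j mod 2) else 0)"
    if "i < 2 * n" "j < 2 * n" for i j
  proof -
    have "i div 2 < n" using that by auto
    then have "Ts ! (i div 2) = cmv_Theta (a (2 * (i div 2) + 1))" by (simp add: Ts_def)
    moreover have "D $$ (i, j)
      = (if i div 2 = j div 2 then Ts ! (i div 2) $$ (i mod 2, j mod 2) else 0)"
      unfolding D_def using Ts that by (intro diag_block_mat_index) auto
    ultimately show ?thesis by (simp only:)
  qed
  have S: "dim_row (scalar_block c) = 1" "dim_col (scalar_block c) = 1"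
    "scalar_block c $$ (0, 0) = c" for c
    by (simp_all add: scalar_block_def mat_of_rows_list_def)
  \<comment> \<open>The two scalar blocks break the uniform block size, so they are split off as the
    outer corners of nested four-block matrices; \<open>diag_block_mat_index\<close> is applied only
    to the inner list \<open>Ts\<close>.\<close>
  have "cmv_M1 N \<omega> a = diag_block_mat (scalar_block 1 # (Ts @ [scalar_block (inverse \<omega>)]))"
    by (simp add: cmv_M1_def Ts_def N)
  also have "\<dots> = four_block_mat (scalar_block 1) (0\<^sub>m 1 (2 * n + 1)) (0\<^sub>m (2 * n + 1) 1)
     (four_block_mat D (0\<^sub>m (2 * n) 1) (0\<^sub>m 1 (2 * n)) (scalar_block (inverse \<omega>)))"
    by (simp add: Let_def diag_block_mat_last S D flip: D_def)
  finally show ?thesis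
    using assms(2,3) unfolding N by (auto simp: S D D_index)
qed

text \<open>The \<open>Suc\<close> skips the leading scalar block; the bounds keep both indices
  strictly between 0 and the last index, so only the Theta blocks are met.\<close>

lemma cmv_M1_inner_index:
  assumes "p < n" and "q < n" and "r < 2" and "s < 2"
  shows "cmv_M1 (2 * n + 1) \<omega> a $$ (Suc (2 * p + r), Suc (2 * q + s))
    = (if p = q then cmv_Theta (a (2 * p + 1)) $$ (r, s) else 0)"
proof -
  have "2 * p + r < 2 * n" "2 * q + s < 2 * n" using assms by auto
  then show ?thesis using assms(3,4) by (subst cmv_M1_index) simp_all
qed

lemma cmv_M2_mirror_dual:
  assumes "odd N" and \<omega>: "cmod \<omega> = 1" and \<tau>: "\<tau>\<^sup>2 = inverse \<omega>"
  shows "cmv_M2 N (mirror_dual N \<omega> a)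
    = quasi_reflection N \<tau> * cmv_M2 N a * quasi_reflection N (inverse \<tau>)" (is "?L = ?R")
proof (rule eq_matI)
  note C = cmv_M2_carrier[OF \<open>odd N\<close>]
  show "dim_row ?L = dim_row ?R" "dim_col ?L = dim_col ?R"
    using carrier_matD[OF C] by (simp_all add: quasi_reflection_def)
  fix k l assume "k < dim_row ?R" "l < dim_col ?R"
  then have kl: "k \<le> N" "l \<le> N" by (simp_all add: quasi_reflection_def)
  obtain m where "N = 2 * m + 1" using \<open>odd N\<close> by (rule oddE)
  \<comment> \<open>Here \<open>n\<close> is the number of blocks of \<open>cmv_M2\<close>, half the
    matrix size \<open>N + 1\<close>.\<close>
  then obtain n where N: "N = 2 * n - 1" "n > 0" by (intro that[of "Suc m"]) auto
  define p r q s where "p = k div 2" and "r = k mod 2" and "q = l div 2" and "s = l mod 2"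
  then have k: "k = 2 * p + r" "r < 2" "p < n" and l: "l = 2 * q + s" "s < 2" "q < n"
    using kl N by auto
  \<comment> \<open>The reversal sends block \<open>p\<close> to block \<open>n - 1 - p\<close> and
    swaps the two positions inside it.\<close>
  have Nk: "N - k = 2 * (n - 1 - p) + (1 - r)" and Nl: "N - l = 2 * (n - 1 - q) + (1 - s)"
    using k l N by auto
  have R: "?R $$ (k, l)
    = \<tau> powi ((-1) ^ k) * \<tau> powi ((-1) ^ l) * cmv_M2 N a $$ (N - k, N - l)"
    using quasi_reflection_conj_index[OF C \<open>odd N\<close> kl, of \<tau> a] .
  have "n - 1 - p = n - 1 - q \<longleftrightarrow> p = q" using k l by auto
  \<comment> \<open>The coefficient of the reflected block is exactly the one that
    \<open>mirror_dual\<close> reads at index \<open>2 * p\<close>.\<close>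
  moreover have "N - 2 * p - 1 = 2 * (n - 1 - p)" using N by simp
  ultimately have "cmv_M2 N a $$ (N - k, N - l)
    = (if p = q then cmv_Theta (a (N - 2 * p - 1)) $$ (1 - r, 1 - s) else 0)"
    unfolding Nk Nl unfolding N(1) using N(2)
    by (subst cmv_M2_index) auto
  moreover have "\<tau> powi ((-1) ^ k) = \<tau> powi ((-1) ^ r)" "\<tau> powi ((-1) ^ l) = \<tau> powi ((-1) ^ s)"
    by (simp_all add: k l power_add power_mult)
  moreover have "?L $$ (k, l)
    = (if p = q then cmv_Theta (- \<omega> * cnj (a (N - 2 * p - 1))) $$ (r, s) else 0)"
    unfolding k(1) l(1) unfolding N(1) using k l by (subst cmv_M2_index) (auto simp: mirror_dual_def)
  ultimately show "?L $$ (k, l) = ?R $$ (k, l)"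
    using cmv_Theta_mirror[OF \<omega> \<tau> k(2) l(2)] R by simp
qed

text \<open>The Theta blocks now start at odd indices, so parity in the matrix is opposite to parity
  inside a block. This is why \<tau> and its inverse trade places compared with
  \<open>cmv_M2_mirror_dual\<close>. The two scalar blocks are exchanged by the reversal and treated
  separately.\<close>

lemma cmv_M1_mirror_dual:
  assumes "odd N" and \<omega>: "cmod \<omega> = 1" and \<tau>: "\<tau>\<^sup>2 = inverse \<omega>"
  shows "cmv_M1 N \<omega> (mirror_dual N \<omega> a)
    = quasi_reflection N (inverse \<tau>) * cmv_M1 N \<omega> a * quasi_reflection N \<tau>" (is "?L = ?R")
proof (rule eq_matI)
  note C = cmv_M1_carrier[OF \<open>odd N\<close>]
  show "dim_row ?L = dim_row ?R" "dim_col ?L = dim_col ?R"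
    using carrier_matD[OF C] by (simp_all add: quasi_reflection_def)
  fix k l assume "k < dim_row ?R" "l < dim_col ?R"
  then have kl: "k \<le> N" "l \<le> N" by (simp_all add: quasi_reflection_def)
  obtain n where N: "N = 2 * n + 1" using \<open>odd N\<close> by (rule oddE)
  have sq: "\<tau> * \<tau> = inverse \<omega>" "inverse \<tau> * inverse \<tau> = \<omega>" "\<omega> \<noteq> 0"
    using \<tau> \<omega> by (auto simp: power2_eq_square simp flip: inverse_mult_distrib)
  have "N \<noteq> 0" using N by simp
  have R: "?R $$ (k, l)
    = inverse \<tau> powi ((-1) ^ k) * inverse \<tau> powi ((-1) ^ l) * cmv_M1 N \<omega> a $$ (N - k, N - l)"
    using quasi_reflection_conj_index[OF C \<open>odd N\<close> kl, of "inverse \<tau>" \<omega> a] by simp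
  show "?L $$ (k, l) = ?R $$ (k, l)"
  proof (cases "k = 0 \<or> k = N \<or> l = 0 \<or> l = N")
    case True
    then consider "k = 0" "l = 0" | "k = N" "l = N" | "k \<noteq> l" by auto
    then show ?thesis
    proof cases
      case 1
      \<comment> \<open>The reflected entry is the inverse of \<omega>, and the two weights multiply
        to \<omega>, which gives 1.\<close>
      then show ?thesis unfolding R using \<open>odd N\<close> \<open>N \<noteq> 0\<close> sq by (simp add: cmv_M1_index)
    next
      case 2
      \<comment> \<open>The reflected entry is 1, and the weights multiply to
        \<open>\<tau>\<^sup>2\<close>, the inverse of \<omega>.\<close>
      then show ?thesis unfolding R using \<open>odd N\<close> \<open>N \<noteq> 0\<close> sq by (simp add: cmv_M1_index power_int_minus)
    next
      case 3
      \<comment> \<open>Border rows and columns vanish off the diagonal, and the reversal maps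
        off-diagonal border positions to such positions, so both sides are 0.\<close>
      have zero: "cmv_M1 N \<omega> b $$ (i, j) = 0"
        if "i \<noteq> j" "i = 0 \<or> i = N \<or> j = 0 \<or> j = N" "i \<le> N" "j \<le> N" for i j b
        unfolding cmv_M1_index[OF \<open>odd N\<close> that(3,4)] using that(1,2) by (elim disjE) simp_all
      have "N - k \<noteq> N - l" using 3 kl by simp
      moreover have "N - k = 0 \<or> N - k = N \<or> N - l = 0 \<or> N - l = N" using True by auto
      ultimately have "cmv_M1 N \<omega> a $$ (N - k, N - l) = 0"
        by (rule zero) simp_all
      moreover have "?L $$ (k, l) = 0"
        using 3 True kl by (intro zero) simp_all
      ultimately show ?thesis unfolding R by simp
    qed
  next
    case False
    define p r q s where "p = (k - 1) div 2" and "r = (k - 1) mod 2"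
      and "q = (l - 1) div 2" and "s = (l - 1) mod 2"
    have "k - 1 = 2 * p + r" "l - 1 = 2 * q + s" by (simp_all add: p_def q_def r_def s_def)
    then have k: "k = Suc (2 * p + r)" "r < 2" "p < n" and l: "l = Suc (2 * q + s)" "s < 2" "q < n"
      using kl N False by (auto simp: r_def s_def)
    have Nk: "N - k = Suc (2 * (n - 1 - p) + (1 - r))" and Nl: "N - l = Suc (2 * (n - 1 - q) + (1 - s))"
      using k l N by auto
    have "n - 1 - p = n - 1 - q \<longleftrightarrow> p = q" using k l by auto
    then have "cmv_M1 N \<omega> a $$ (N - k, N - l)
      = (if p = q then cmv_Theta (a (2 * (n - 1 - p) + 1)) $$ (1 - r, 1 - s) else 0)"
      unfolding Nk Nl unfolding N using k(3) l(3) by (subst cmv_M1_inner_index) simp_all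
    also have "2 * (n - 1 - p) + 1 = N - (2 * p + 1) - 1" using k N by simp
    finally have "cmv_M1 N \<omega> a $$ (N - k, N - l)
      = (if p = q then cmv_Theta (a (N - (2 * p + 1) - 1)) $$ (1 - r, 1 - s) else 0)" .
    \<comment> \<open>As \<open>k\<close> is \<open>Suc (2 * p + r)\<close>, its parity is opposite
      to that of \<open>r\<close>; the flipped exponent turns the inverse of \<tau> back into
      \<tau>, as \<open>cmv_Theta_mirror\<close> requires.\<close>
    moreover have "inverse \<tau> powi ((-1) ^ k) = \<tau> powi ((-1) ^ r)"
      "inverse \<tau> powi ((-1) ^ l) = \<tau> powi ((-1) ^ s)"
      by (simp_all add: k l power_add power_mult power_int_minus power_int_inverse)
    moreover have "?L $$ (k, l)
      = (if p = q then cmv_Theta (- \<omega> * cnj (a (N - (2 * p + 1) - 1))) $$ (r, s) else 0)"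
      unfolding k(1) l(1) unfolding N using k(2,3) l(2,3)
      by (subst cmv_M1_inner_index) (simp_all add: mirror_dual_def)
    ultimately show ?thesis
      using cmv_Theta_mirror[OF \<omega> \<tau> k(2) l(2)] R by simp
  qed
qed

theorem proposition7p3:
  fixes N :: nat and \<omega> \<tau> :: complex and a :: "nat \<Rightarrow> complex"
  assumes "N \<ge> 1" and "odd N"
    and "cmod \<omega> = 1"
    and "\<And>n. n < N \<Longrightarrow> cmod (a n) < 1"
    and "\<tau>\<^sup>2 = inverse \<omega>"
  shows "cmv_M1 N \<omega> (mirror_dual N \<omega> a)
           = quasi_reflection N (inverse \<tau>) * cmv_M1 N \<omega> a * quasi_reflection N \<tau>
       \<and> cmv_M2 N (mirror_dual N \<omega> a)
           = quasi_reflection N \<tau> * cmv_M2 N a * quasi_reflection N (inverse \<tau>)"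
  using cmv_M1_mirror_dual cmv_M2_mirror_dual assms by blast

end
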